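(* Let $\mathcal{F}$ be an arbitrary field, and let $M_n(\mathcal{F})$ be the algebra of $n\times n$ matrices over $\mathcal{F}$, $n>1$. Then any additive local inner derivation on the algebra $M_n(\mathcal{F})$ is an inner derivation.
   Context: For an associative algebra $\mathcal{A}$ and $a\in\mathcal{A}$, let $D_a:\mathcal{A}\to\mathcal{A}$ be $D_a(x)=ax-xa$; maps of this form are called inner derivations of $\mathcal{A}$. An additive (not necessarily homogeneous) map $\nabla:\mathcal{A}\to\mathcal{A}$ is called an additive local inner derivation if for every $x\in\mathcal{A}$ there exists $a\in\mathcal{A}$ (depending on $x$) such that $\nabla(x)=D_a(x)$. *)

theory Defs
  imports "HOL-Analysis.Analysis"
begin

(* The product m is a parameter, and not a type-class operation: on the type 'f^'n^'n the
   operation ( * ) is the entrywise product, whereas the algebra of matrices carries ( ** ). *)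

definition inner_der :: "('a \<Rightarrow> 'a \<Rightarrow> 'a) \<Rightarrow> 'a \<Rightarrow> 'a \<Rightarrow> 'a::ab_group_add" where
  "inner_der m a x = m a x - m x a"

definition is_inner_derivation ::
    "('a \<Rightarrow> 'a \<Rightarrow> 'a) \<Rightarrow> ('a \<Rightarrow> 'a::ab_group_add) \<Rightarrow> bool" where
  "is_inner_derivation m f \<longleftrightarrow> (\<exists>a. f = inner_der m a)"

(* Modules.additive is additivity of maps between abelian groups, without any compatibility
   with scalars; the short name additive denotes additivity of set functions. *)

definition additive_local_inner_derivation ::
    "('a \<Rightarrow> 'a \<Rightarrow> 'a) \<Rightarrow> ('a \<Rightarrow> 'a::ab_group_add) \<Rightarrow> bool" where
  "additive_local_inner_derivation m f \<longleftrightarrow>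
     Modules.additive f \<and> (\<forall>x. \<exists>a. f x = inner_der m a x)"

end

theory Submission
  imports Defs
begin

text \<open>
  To an additive local inner derivation \<open>D\<close> belongs the biadditive form
  \<open>B x y = trace (D x ** y)\<close>. If \<open>D x = a ** x - x ** a\<close> and \<open>y\<close> commutes with \<open>x\<close>, then
  \<open>B x y = trace (a ** (x ** y - y ** x)) = 0\<close>, so \<open>B\<close> vanishes on commuting pairs. It is
  therefore alternating, hence antisymmetric (\<open>trace_form_antisym\<close>). This makes up for the missing
  homogeneity of \<open>D\<close>.

  Antisymmetry makes the matrix units decisive: if \<open>D\<close> kills every matrix unit \<open>e\<close>, then
  \<open>trace (D x ** e) = - trace (D e ** x) = 0\<close> for every \<open>x\<close>, and since these traces are the
  entries of \<open>D x\<close>, \<open>D = 0\<close> (\<open>zero_if_zero_on_matrix_units\<close>). No expansion of \<open>x\<close> in matrix units,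
  which would require \<open>D\<close> to respect scalars, is involved.

  It remains to find one matrix \<open>a\<close> with \<open>D e = a ** e - e ** a\<close> for all matrix units \<open>e\<close>
  (\<open>inner_on_matrix_units\<close>), because then the additive map \<open>\<lambda>x. D x - (a ** x - x ** a)\<close> is again
  local inner and kills the matrix units. The equation for \<open>e\<close> says
  \<open>B e e' = trace (a ** (e ** e' - e' ** e))\<close> for all matrix units \<open>e'\<close>, so \<open>B e e'\<close> must depend only
  on the commutator of \<open>e\<close> and \<open>e'\<close>. For matrix units with off-diagonal commutator this follows from
  the commuting pair \<open>e\<^sub>i\<^sub>j + e\<^sub>i\<^sub>k\<close>, \<open>e\<^sub>j\<^sub>l - e\<^sub>k\<^sub>l\<close>. For the diagonal commutators \<open>e\<^sub>i\<^sub>i - e\<^sub>j\<^sub>j\<close> it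
  follows from the cyclic matrix \<open>e\<^sub>i\<^sub>j + e\<^sub>j\<^sub>k + e\<^sub>k\<^sub>i\<close>, which commutes with its square.
\<close>

definition matrix_unit :: "'n \<Rightarrow> 'n \<Rightarrow> 'f::comm_ring_1 ^ 'n ^ 'n" where
  "matrix_unit i j = (\<chi> r c. if r = i \<and> c = j then 1 else 0)"

lemma matrix_mult_matrix_unit_nth:
  fixes A :: "'f::comm_ring_1 ^ 'n ^ 'n"
  shows "(A ** matrix_unit i j) $ l $ k = (if k = j then A $ l $ i else 0)"
  by (simp add: matrix_matrix_mult_def matrix_unit_def if_distrib cong: if_cong)

lemma matrix_unit_matrix_mult_nth:
  fixes A :: "'f::comm_ring_1 ^ 'n ^ 'n"
  shows "(matrix_unit i j ** A) $ l $ k = (if l = i then A $ j $ k else 0)"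
  by (simp add: matrix_matrix_mult_def matrix_unit_def if_distrib if_distribR cong: if_cong)

lemma matrix_unit_mult:
  "matrix_unit i j ** matrix_unit k l =
    (if j = k then matrix_unit i l else (0 :: 'f::comm_ring_1 ^ 'n ^ 'n))"
  by (auto simp: vec_eq_iff matrix_unit_matrix_mult_nth) (auto simp: matrix_unit_def)

lemma trace_mult_matrix_unit:
  fixes A :: "'f::comm_ring_1 ^ 'n ^ 'n"
  shows "trace (A ** matrix_unit k l) = A $ l $ k"
  by (simp add: trace_def matrix_mult_matrix_unit_nth)

lemma matrix_add_rdistrib:
  fixes A :: "'f::comm_ring_1 ^ 'n ^ 'n"
  shows "(A + B) ** C = A ** C + B ** C"
  by (simp add: vec_eq_iff matrix_matrix_mult_def algebra_simps sum.distrib)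

lemma matrix_diff_ldistrib:
  fixes A :: "'f::comm_ring_1 ^ 'n ^ 'n"
  shows "A ** (B - C) = A ** B - A ** C"
  by (simp add: vec_eq_iff matrix_matrix_mult_def algebra_simps sum_subtractf)

lemma matrix_diff_rdistrib:
  fixes A :: "'f::comm_ring_1 ^ 'n ^ 'n"
  shows "(A - B) ** C = A ** C - B ** C"
  by (simp add: vec_eq_iff matrix_matrix_mult_def algebra_simps sum_subtractf)

lemma trace_inner_der_commuting:
  fixes a x y :: "'f::comm_ring_1 ^ 'n ^ 'n"
  assumes "x ** y = y ** x"
  shows "trace (inner_der (**) a x ** y) = 0"
proof -
  have "trace (x ** a ** y) = trace (a ** y ** x)"
    by (metis matrix_mul_assoc trace_mul_sym)
  also have "\<dots> = trace (a ** x ** y)"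
    by (metis assms matrix_mul_assoc)
  finally show ?thesis
    by (simp add: inner_der_def matrix_diff_rdistrib trace_sub)
qed

definition trace_form ::
    "('f ^ 'n ^ 'n \<Rightarrow> 'f ^ 'n ^ 'n) \<Rightarrow> 'f ^ 'n ^ 'n \<Rightarrow> 'f ^ 'n ^ 'n \<Rightarrow> 'f::comm_ring_1" where
  "trace_form D x y = trace (D x ** y)"

lemma trace_form_add_right: "trace_form D x (y + z) = trace_form D x y + trace_form D x z"
  by (simp add: trace_form_def matrix_add_ldistrib trace_add)

lemma trace_form_diff_right: "trace_form D x (y - z) = trace_form D x y - trace_form D x z"
  by (simp add: trace_form_def matrix_diff_ldistrib trace_sub)

lemma trace_form_matrix_unit: "trace_form D x (matrix_unit k l) = D x $ l $ k"
  by (simp add: trace_form_def trace_mult_matrix_unit)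

context
  fixes D :: "'f::comm_ring_1 ^ 'n ^ 'n \<Rightarrow> 'f ^ 'n ^ 'n"
  assumes local_inner: "additive_local_inner_derivation (**) D"
begin

lemma trace_form_add_left: "trace_form D (x + y) z = trace_form D x z + trace_form D y z"
  using local_inner
  by (simp add: additive_local_inner_derivation_def Modules.additive_def trace_form_def
      matrix_add_rdistrib trace_add)

lemma trace_form_commuting: "x ** y = y ** x \<Longrightarrow> trace_form D x y = 0"
  using local_inner trace_inner_der_commuting
  unfolding additive_local_inner_derivation_def trace_form_def by metis

lemma trace_form_antisym: "trace_form D x y = - trace_form D y x"
proof -
  have "trace_form D (x + y) (x + y) = 0" "trace_form D x x = 0" "trace_form D y y = 0"
    by (simp_all add: trace_form_commuting)
  then have "trace_form D x y + trace_form D y x = 0"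
    by (simp add: trace_form_add_left trace_form_add_right add.commute)
  then show ?thesis
    by (simp add: eq_neg_iff_add_eq_0)
qed

text \<open>By antisymmetry, the entries of \<open>D x\<close> are, up to sign, values of the form at a matrix unit in
  the first argument.\<close>

lemma zero_if_zero_on_matrix_units:
  assumes "\<And>i j. D (matrix_unit i j) = 0"
  shows "D x = 0"
proof -
  have "D x $ l $ k = 0" for k l
  proof -
    have "D x $ l $ k = - trace_form D (matrix_unit k l) x"
      using trace_form_antisym trace_form_matrix_unit by metis
    also have "\<dots> = 0"
      by (simp add: trace_form_def assms matrix_matrix_mult_def trace_def)
    finally show ?thesis .
  qed
  then show ?thesis
    by (simp add: vec_eq_iff)
qed

lemma trace_form_matrix_units_disjoint:
  assumes "j \<noteq> k" "i \<noteq> l"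
  shows "trace_form D (matrix_unit i j) (matrix_unit k l) = 0"
  using assms by (intro trace_form_commuting) (simp add: matrix_unit_mult)

text \<open>The product \<open>e\<^sub>i\<^sub>j ** e\<^sub>j\<^sub>l\<close> does not depend on \<open>j\<close>, so the matrices
  \<open>e\<^sub>i\<^sub>j + e\<^sub>i\<^sub>k\<close> and \<open>e\<^sub>j\<^sub>l - e\<^sub>k\<^sub>l\<close> have product zero in either order.\<close>

lemma trace_form_off_diagonal:
  assumes "i \<noteq> l"
  shows "trace_form D (matrix_unit i j) (matrix_unit j l) =
    trace_form D (matrix_unit i k) (matrix_unit k l)"
proof (cases "j = k")
  case False
  have "trace_form D (matrix_unit i j + matrix_unit i k) (matrix_unit j l - matrix_unit k l) = 0"
    using False assms
    by (intro trace_form_commuting)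
      (simp add: matrix_diff_ldistrib matrix_diff_rdistrib matrix_add_ldistrib matrix_add_rdistrib
        matrix_unit_mult)
  then show ?thesis
    using False assms
    by (simp add: trace_form_add_left trace_form_diff_right trace_form_matrix_units_disjoint)
qed simp

text \<open>The cocycle identity is what makes \<open>trace_form D e\<^sub>i\<^sub>j e\<^sub>j\<^sub>i\<close> a difference \<open>f i - f j\<close>, as it has
  to be if it is a linear function of the commutator \<open>e\<^sub>i\<^sub>i - e\<^sub>j\<^sub>j\<close>. For distinct indices, pair
  \<open>c = e\<^sub>i\<^sub>j + e\<^sub>j\<^sub>k + e\<^sub>k\<^sub>i\<close> with \<open>c ** c\<close>: the only terms of the expansion that survive are those of
  each unit in \<open>c\<close> with its transpose.\<close>

lemma trace_form_diagonal_cocycle: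
  "trace_form D (matrix_unit i j) (matrix_unit j i) +
   trace_form D (matrix_unit j k) (matrix_unit k j) =
   trace_form D (matrix_unit i k) (matrix_unit k i)"
proof (cases "i = j \<or> j = k \<or> i = k")
  case True
  have "trace_form D (matrix_unit p p) (matrix_unit p p) = 0" for p
    by (simp add: trace_form_commuting)
  with True show ?thesis
    using trace_form_antisym[of "matrix_unit i j" "matrix_unit j i"] by auto
next
  case False
  then have neq: "i \<noteq> j" "j \<noteq> k" "i \<noteq> k" "j \<noteq> i" "k \<noteq> j" "k \<noteq> i"
    by auto
  let ?c = "matrix_unit i j + matrix_unit j k + matrix_unit k i :: 'f ^ 'n ^ 'n"
  have "?c ** ?c = matrix_unit j i + matrix_unit k j + matrix_unit i k"
    using neq by (simp add: matrix_add_ldistrib matrix_add_rdistrib matrix_unit_mult)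
  moreover have "trace_form D ?c (?c ** ?c) = 0"
    by (intro trace_form_commuting) (simp add: matrix_mul_assoc)
  ultimately have "trace_form D ?c (matrix_unit j i + matrix_unit k j + matrix_unit i k) = 0"
    by simp
  then have "trace_form D (matrix_unit i j) (matrix_unit j i) +
      trace_form D (matrix_unit j k) (matrix_unit k j) +
      trace_form D (matrix_unit k i) (matrix_unit i k) = 0"
    using neq
    by (simp add: trace_form_add_left trace_form_add_right trace_form_matrix_units_disjoint
        add.assoc)
  then show ?thesis
    using trace_form_antisym[of "matrix_unit k i" "matrix_unit i k"] by simp
qed

text \<open>The matrix \<open>a\<close> represents the linear functional \<open>f\<close>, with \<open>f z = trace (a ** z)\<close>, that sends each
  commutator of matrix units to the value of the form on the pair; thus \<open>f (matrix_unit p q)\<close> is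
  the entry of \<open>a\<close> in row \<open>q\<close> and column \<open>p\<close>. The values of \<open>f\<close> on the diagonal are determined only up
  to a common additive constant, because \<open>a\<close> matters only up to scalar matrices.\<close>

lemma inner_on_matrix_units:
  "\<exists>a. \<forall>i j. D (matrix_unit i j) = inner_der (**) a (matrix_unit i j)"
proof -
  let ?B = "\<lambda>i j k l. trace_form D (matrix_unit i j) (matrix_unit k l)"
  \<comment> \<open>The free constant is fixed by requiring \<open>f (matrix_unit base base) = 0\<close>.\<close>
  fix base :: 'n
  define a :: "'f ^ 'n ^ 'n" where
    "a = (\<chi> q p. if p = q then ?B p base base p else ?B p p p q)"
  have "D (matrix_unit i j) $ l $ k = inner_der (**) a (matrix_unit i j) $ l $ k" for i j k l
  proof -
    have rhs: "inner_der (**) a (matrix_unit i j) $ l $ k =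
        (if k = j then a $ l $ i else 0) - (if l = i then a $ j $ k else 0)"
      by (simp add: inner_der_def matrix_mult_matrix_unit_nth matrix_unit_matrix_mult_nth)
    have diagonal: "?B i j j i = a $ i $ i - a $ j $ j"
      using trace_form_diagonal_cocycle[of i j base] by (simp add: a_def algebra_simps)
    have off_diagonal: "?B p r r q = a $ q $ p" if "p \<noteq> q" for p q r
      using that trace_form_off_diagonal[of p q r p] by (simp add: a_def)
    have "?B i j k l = (if k = j then a $ l $ i else 0) - (if l = i then a $ j $ k else 0)"
    proof (cases "k = j"; cases "l = i")
      assume "k \<noteq> j" "l = i"
      then show ?thesis
        using off_diagonal[of k j i] trace_form_antisym[of "matrix_unit i j" "matrix_unit k i"]
        by simp
    qed (use diagonal off_diagonal[of i l j] trace_form_matrix_units_disjoint[of j k i l] in auto)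
    then show ?thesis
      by (simp add: rhs trace_form_matrix_unit)
  qed
  then show ?thesis
    unfolding vec_eq_iff by blast
qed

end

lemma additive_local_inner_derivation_diff_inner_der:
  fixes D :: "'f::comm_ring_1 ^ 'n ^ 'n \<Rightarrow> 'f ^ 'n ^ 'n"
  assumes "additive_local_inner_derivation (**) D"
  shows "additive_local_inner_derivation (**) (\<lambda>x. D x - inner_der (**) a x)"
proof -
  have "D (x + y) - inner_der (**) a (x + y) =
      (D x - inner_der (**) a x) + (D y - inner_der (**) a y)" for x y
    using assms
    by (simp add: additive_local_inner_derivation_def Modules.additive_def inner_der_def
        matrix_add_ldistrib matrix_add_rdistrib)
  moreover have "\<exists>b. D x - inner_der (**) a x = inner_der (**) b x" for x
  proof -
    obtain b where "D x = inner_der (**) b x"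
      using assms by (auto simp: additive_local_inner_derivation_def)
    then have "D x - inner_der (**) a x = inner_der (**) (b - a) x"
      by (simp add: inner_der_def matrix_diff_ldistrib matrix_diff_rdistrib)
    then show ?thesis ..
  qed
  ultimately show ?thesis
    by (simp add: additive_local_inner_derivation_def Modules.additive_def)
qed

theorem theorem2p14:
  fixes D :: "'f::field ^ 'n ^ 'n \<Rightarrow> 'f ^ 'n ^ 'n"
  assumes "CARD('n) > 1"
    and "additive_local_inner_derivation (**) D"
  shows "is_inner_derivation (**) D"
proof -
  obtain a where a: "D (matrix_unit i j) = inner_der (**) a (matrix_unit i j)" for i j
    using inner_on_matrix_units[OF assms(2)] by blast
  have "D x - inner_der (**) a x = 0" for x
    using additive_local_inner_derivation_diff_inner_der[OF assms(2)]
    by (rule zero_if_zero_on_matrix_units) (simp add: a)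
  then show ?thesis
    by (auto simp: is_inner_derivation_def)
qed

end
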